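(* For every $\lambda>0$, $\psi(M,N,\lambda)$ is closed in $\mathcal{B}\mathcal{C}_D(M,N)$; that is, $\psi(M,N,\lambda)\cap\mathcal{B}\mathcal{C}_D(M,N)$ is a closed subset of $\mathcal{B}\mathcal{C}_D(M,N)$ in the subspace topology induced by the operator norm of $\mathcal{B}(\mathcal{H},\mathcal{K})$.
   Context: $\mathcal{H}$ and $\mathcal{K}$ are real or complex Hilbert spaces, $\mathcal{B}(\mathcal{H},\mathcal{K})$ is the space of bounded linear operators from $\mathcal{H}$ to $\mathcal{K}$. $\mathcal{R}(\cdot)$ denotes range and $*$ denotes adjoint. $M\subseteq\mathcal{H}$ and $N\subseteq\mathcal{K}$ are closed subspaces. Block matrices $T=\begin{pmatrix}A&B\\C&D\end{pmatrix}$ are taken with respect to $\mathcal{H}=M\oplus M^\perp$ and $\mathcal{K}=N\oplus N^\perp$, so $A:M\to N$, $B:M^\perp\to N$, $C:M\to N^\perp$, $D:M^\perp\to N^\perp$. For a closed subspace $L$, $\mathcal{B}_L=\{x\in L:\|x\|\le1\}$. For $\lambda>0$, $\psi(M,N,\lambda)$ is the set of $(M,N,\lambda)$-complementable operators, i.e. those $T\in\mathcal{B}(\mathcal{H},\mathcal{K})$ with $C(\mathcal{B}_M)\subseteq\lambda D(\mathcal{B}_{M^\perp})$ and $B^*(\mathcal{B}_N)\subseteq\lambda D^*(\mathcal{B}_{N^\perp})$. $\mathcal{B}\mathcal{C}_D(M,N)$ is the set of $T\in\mathcal{B}(\mathcal{H},\mathcal{K})$ whose block $D$ has closed range $\mathcal{R}(D)$.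 *)

theory Defs
  imports "HOL-Analysis.Analysis"
begin

text \<open>
  Hilbert spaces are real or complex.  The class below treats both scalar fields at once: its
  instances include \<open>real\<close> with trivial conjugation and \<open>complex\<close> with the usual one.  By the
  Gelfand--Mazur theorem there are no others up to isomorphism, and the conjugation is determined
  by the second axiom.
\<close>

class rc_field = real_normed_field +
  fixes scalar_cnj :: "'a \<Rightarrow> 'a"
  assumes scalar_cnj_add: "scalar_cnj (a + b) = scalar_cnj a + scalar_cnj b"
    and mult_scalar_cnj: "a * scalar_cnj a = (norm a)\<^sup>2 *\<^sub>R 1"

instantiation real :: rc_field
begin
definition scalar_cnj_real :: "real \<Rightarrow> real" where "scalar_cnj_real a = a"
instance by standard (simp_all add: scalar_cnj_real_def power2_eq_square)
end

instantiation complex :: rc_field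
begin
definition scalar_cnj_complex :: "complex \<Rightarrow> complex" where "scalar_cnj_complex a = cnj a"
instance by standard (simp_all add: scalar_cnj_complex_def scaleR_conv_of_real complex_norm_square[symmetric])
end

text \<open>
  A Hilbert space over \<open>'k\<close>.  Completeness comes from the class \<open>banach\<close>, whose real scalar
  multiplication, norm and topology are tied to \<open>scale\<close> and \<open>ip\<close> by the axioms \<open>scale_of_real\<close> and
  \<open>ip_self\<close>.  The inner product is linear in its first argument.
\<close>

locale hilbert_space = vector_space scale
  for scale :: "'k::rc_field \<Rightarrow> 'a::banach \<Rightarrow> 'a" +
  fixes ip :: "'a \<Rightarrow> 'a \<Rightarrow> 'k"
  assumes scale_of_real: "scale (of_real r) x = r *\<^sub>R x"
    and ip_add_left: "ip (x + y) z = ip x z + ip y z"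
    and ip_scale_left: "ip (scale c x) y = c * ip x y"
    and ip_commute: "ip y x = scalar_cnj (ip x y)"
    and ip_self: "ip x x = of_real ((norm x)\<^sup>2)"

lemma hilbert_space_real:
  "hilbert_space (scaleR :: real \<Rightarrow> 'a \<Rightarrow> 'a::{real_inner, banach}) inner"
  by unfold_locales
    (simp_all add: scalar_cnj_real_def inner_add_left inner_add_right power2_norm_eq_inner
      scaleR_add_right scaleR_add_left inner_commute)

lemma hilbert_space_complex:
  "hilbert_space (times :: complex \<Rightarrow> complex \<Rightarrow> complex) (\<lambda>x y. x * cnj y)"
  by unfold_locales
    (simp_all add: scalar_cnj_complex_def scaleR_conv_of_real algebra_simps
      complex_norm_square[symmetric])

definition ortho_compl :: "('a \<Rightarrow> 'a \<Rightarrow> 'k::zero) \<Rightarrow> 'a set \<Rightarrow> 'a set"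
  where "ortho_compl ip L = {x. \<forall>y\<in>L. ip x y = 0}"

definition ortho_proj :: "('a::ab_group_add \<Rightarrow> 'a \<Rightarrow> 'k::zero) \<Rightarrow> 'a set \<Rightarrow> 'a \<Rightarrow> 'a"
  where "ortho_proj ip L x = (THE p. p \<in> L \<and> x - p \<in> ortho_compl ip L)"

definition unit_ball_of :: "'a::real_normed_vector set \<Rightarrow> 'a set"
  where "unit_ball_of L = {x \<in> L. norm x \<le> 1}"

text \<open>
  \<open>'a \<Rightarrow>\<^sub>L 'b\<close> contains all bounded real-linear maps, with the operator norm; the bounded
  operators over \<open>'k\<close> are those that commute with the scalars.
\<close>

definition bounded_ops ::
  "('k \<Rightarrow> 'a \<Rightarrow> 'a) \<Rightarrow> ('k \<Rightarrow> 'b \<Rightarrow> 'b) \<Rightarrow> ('a::real_normed_vector \<Rightarrow>\<^sub>L 'b::real_normed_vector) set"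
  where "bounded_ops scaleH scaleK =
    {T. \<forall>c x. blinfun_apply T (scaleH c x) = scaleK c (blinfun_apply T x)}"

text \<open>
  The block of \<open>T\<close> from \<open>X\<close> to \<open>Y\<close> is the restriction to \<open>X\<close> of \<open>block ip Y T\<close>, where \<open>ip\<close> is the
  inner product of the codomain.  The domain \<open>X\<close> is supplied where the block is used: in images
  and, explicitly, in \<open>adjoint_on\<close>.
\<close>

definition block ::
  "('b \<Rightarrow> 'b \<Rightarrow> 'k::zero) \<Rightarrow> 'b set \<Rightarrow> ('a::real_normed_vector \<Rightarrow>\<^sub>L 'b::real_normed_vector) \<Rightarrow> 'a \<Rightarrow> 'b"
  where "block ip Y T x = ortho_proj ip Y (blinfun_apply T x)"

text \<open>
  The adjoint of an operator \<open>F : X \<rightarrow> Y\<close> between closed subspaces, as a map \<open>Y \<rightarrow> X\<close>;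
  it is meant to be applied to \<open>y \<in> Y\<close> only.
\<close>

definition adjoint_on ::
  "('a \<Rightarrow> 'a \<Rightarrow> 'k) \<Rightarrow> ('b \<Rightarrow> 'b \<Rightarrow> 'k) \<Rightarrow> 'a set \<Rightarrow> ('a \<Rightarrow> 'b) \<Rightarrow> 'b \<Rightarrow> 'a"
  where "adjoint_on ipH ipK X F y = (THE x. x \<in> X \<and> (\<forall>u\<in>X. ipK (F u) y = ipH u x))"

definition complementable_ops ::
  "('k::zero \<Rightarrow> 'a \<Rightarrow> 'a) \<Rightarrow> ('a \<Rightarrow> 'a \<Rightarrow> 'k) \<Rightarrow> ('k \<Rightarrow> 'b \<Rightarrow> 'b) \<Rightarrow> ('b \<Rightarrow> 'b \<Rightarrow> 'k) \<Rightarrow>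
   'a set \<Rightarrow> 'b set \<Rightarrow> real \<Rightarrow> ('a::real_normed_vector \<Rightarrow>\<^sub>L 'b::real_normed_vector) set"
  where "complementable_ops scaleH ipH scaleK ipK M N lam =
    {T \<in> bounded_ops scaleH scaleK.
       let M' = ortho_compl ipH M; N' = ortho_compl ipK N;
           B = block ipK N T; C = block ipK N' T; D = block ipK N' T;
           B_adj = adjoint_on ipH ipK M' B; D_adj = adjoint_on ipH ipK M' D
       in C ` unit_ball_of M \<subseteq> (\<lambda>y. lam *\<^sub>R y) ` D ` unit_ball_of M' \<and>
          B_adj ` unit_ball_of N \<subseteq> (\<lambda>x. lam *\<^sub>R x) ` D_adj ` unit_ball_of N'}"

definition closed_range_D_ops ::
  "('k::zero \<Rightarrow> 'a \<Rightarrow> 'a) \<Rightarrow> ('a \<Rightarrow> 'a \<Rightarrow> 'k) \<Rightarrow> ('k \<Rightarrow> 'b \<Rightarrow> 'b) \<Rightarrow> ('b \<Rightarrow> 'b \<Rightarrow> 'k) \<Rightarrow>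
   'a set \<Rightarrow> 'b set \<Rightarrow> ('a::real_normed_vector \<Rightarrow>\<^sub>L 'b::real_normed_vector) set"
  where "closed_range_D_ops scaleH ipH scaleK ipK M N =
    {T \<in> bounded_ops scaleH scaleK.
       closed (block ipK (ortho_compl ipK N) T ` ortho_compl ipH M)}"

end

theory Submission
  imports Defs
begin

text \<open>
  If \<open>T\<^sub>n \<longlonglongrightarrow> T\<close> and \<open>C\<^sub>n x = \<lambda> D\<^sub>n u\<^sub>n\<close> with \<open>u\<^sub>n\<close> in the unit ball, then
  \<open>\<lambda> D u\<^sub>n \<longlonglongrightarrow> C x\<close>, so \<open>C x\<close> lies in the closure of the image of the unit ball under \<open>\<lambda> D\<close>.
  The image of a closed bounded convex subset of a Hilbert space under a bounded operator is
  closed, since nested sequences of such sets have nonempty intersection by the parallelogram law.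
  The same argument applies to the adjoint inclusion, because the adjoint depends
  1-Lipschitz-continuously on the operator, and both \<open>B\<^sup>*\<close> and \<open>D\<^sup>*\<close> are restrictions of the
  adjoint of the restriction of \<open>T\<close> to \<open>M\<^sup>\<bottom>\<close>.
\<close>

section \<open>The conjugation of the scalar field\<close>

lemma scalar_cnj_0 [simp]: "scalar_cnj (0::'k::rc_field) = 0"
  using scalar_cnj_add[of "0::'k" 0] by simp

lemma norm_scalar_cnj [simp]: "norm (scalar_cnj (a::'k::rc_field)) = norm a"
proof (cases "a = 0")
  case False
  have "norm (a * scalar_cnj a) = (norm a)\<^sup>2"
    by (simp only: mult_scalar_cnj) simp
  then show ?thesis
    using False by (simp add: norm_mult power2_eq_square)
qed simp

text \<open>Cancelling the nonzero \<open>a\<close> in \<open>mult_scalar_cnj\<close> leaves only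
  one candidate for the conjugate. Multiplicativity and involutivity, which the class does not
  assume, are derived this way.\<close>

lemma scalar_cnj_eqI:
  fixes a b :: "'k::rc_field"
  assumes "a * b = of_real ((norm a)\<^sup>2)" and "a \<noteq> 0"
  shows "scalar_cnj a = b"
  using assms mult_scalar_cnj[of a] by (metis mult_left_cancel of_real_def)

lemma scalar_cnj_of_real [simp]: "scalar_cnj (of_real r :: 'k::rc_field) = of_real r"
  by (cases "r = 0") (auto intro!: scalar_cnj_eqI simp: power2_eq_square simp flip: of_real_mult)

lemma scalar_cnj_mult: "scalar_cnj (a * b :: 'k::rc_field) = scalar_cnj a * scalar_cnj b"
proof (cases "a * b = 0")
  case False
  have "a * b * (scalar_cnj a * scalar_cnj b) = (a * scalar_cnj a) * (b * scalar_cnj b)"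
    by (simp add: ac_simps)
  also have "\<dots> = of_real ((norm (a * b))\<^sup>2)"
    by (simp only: mult_scalar_cnj) (simp add: norm_mult power_mult_distrib of_real_def)
  finally show ?thesis
    using False by (rule scalar_cnj_eqI)
qed auto

lemma scalar_cnj_scalar_cnj [simp]: "scalar_cnj (scalar_cnj a) = (a::'k::rc_field)"
proof (cases "a = 0")
  case False
  then have "scalar_cnj a \<noteq> 0"
    by (metis norm_eq_zero norm_scalar_cnj)
  moreover have "scalar_cnj a * a = of_real ((norm (scalar_cnj a))\<^sup>2)"
    using mult_scalar_cnj[of a] by (simp add: of_real_def mult.commute)
  ultimately show ?thesis
    by (intro scalar_cnj_eqI)
qed simp

section \<open>Hilbert spaces\<close>

context hilbert_space
begin

section \<open>Inner product calculus and images of closed bounded convex sets\<close>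

lemma ip_add_right: "ip x (y + z) = ip x y + ip x z"
  by (metis ip_commute ip_add_left scalar_cnj_add)

lemma ip_scale_right: "ip x (scale c y) = scalar_cnj c * ip x y"
  by (metis ip_commute ip_scale_left scalar_cnj_mult)

lemma ip_scaleR_left: "ip (r *\<^sub>R x) y = of_real r * ip x y"
  by (metis ip_scale_left scale_of_real)

lemma ip_scaleR_right: "ip x (r *\<^sub>R y) = of_real r * ip x y"
  by (metis ip_scale_right scale_of_real scalar_cnj_of_real)

lemma ip_zero_left [simp]: "ip 0 x = 0"
  using ip_add_left[of 0 0 x] by simp

lemma ip_zero_right [simp]: "ip x 0 = 0"
  using ip_add_right[of x 0 0] by simp

lemma ip_diff_left: "ip (x - y) z = ip x z - ip y z"
  using ip_add_left[of "x - y" y z] by simp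

lemma ip_diff_right: "ip x (y - z) = ip x y - ip x z"
  using ip_add_right[of x "y - z" z] by simp

lemma parallelogram:
  fixes x y :: 'a
  shows "(norm (x + y))\<^sup>2 + (norm (x - y))\<^sup>2 = 2 * (norm x)\<^sup>2 + 2 * (norm y)\<^sup>2"
proof -
  have "ip (x + y) (x + y) + ip (x - y) (x - y) = 2 * ip x x + 2 * ip y y"
    by (simp add: ip_add_left ip_add_right ip_diff_left ip_diff_right)
  \<comment> \<open>The identity was obtained in the scalar field; injectivity of
    \<open>of_real\<close> brings it back to the reals.\<close>
  then have "of_real ((norm (x + y))\<^sup>2 + (norm (x - y))\<^sup>2) =
      (of_real (2 * (norm x)\<^sup>2 + 2 * (norm y)\<^sup>2) :: 'k)"
    by (simp add: ip_self)
  then show ?thesis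
    by (simp only: of_real_eq_iff)
qed

text \<open>With a coefficient that is a real multiple of \<open>ip z y\<close>, the cross terms
  become real over either scalar field. The parameter \<open>t\<close> stays free because it is
  chosen twice: for Cauchy-Schwarz and for the orthogonality of the closest-point residual.\<close>

lemma norm_diff_scale_ip:
  "(norm (z - scale (of_real t * ip z y) y))\<^sup>2 =
     (norm z)\<^sup>2 - 2 * t * (norm (ip z y))\<^sup>2 + t\<^sup>2 * (norm (ip z y))\<^sup>2 * (norm y)\<^sup>2"
proof -
  let ?a = "ip z y"
  have a: "?a * scalar_cnj ?a = of_real ((norm ?a)\<^sup>2)"
    by (simp only: mult_scalar_cnj of_real_def)
  have "ip (z - scale (of_real t * ?a) y) (z - scale (of_real t * ?a) y) =
      ip z z - 2 * of_real t * (?a * scalar_cnj ?a)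
        + (of_real t)\<^sup>2 * (?a * scalar_cnj ?a) * ip y y"
    by (simp add: ip_diff_left ip_diff_right ip_scale_left ip_scale_right scalar_cnj_mult
        ip_commute[of z y] algebra_simps power2_eq_square)
  also have "\<dots> = of_real ((norm z)\<^sup>2 - 2 * t * (norm ?a)\<^sup>2 + t\<^sup>2 * (norm ?a)\<^sup>2 * (norm y)\<^sup>2)"
    unfolding a ip_self by simp
  finally show ?thesis
    unfolding ip_self by (simp only: of_real_eq_iff)
qed

lemma Cauchy_Schwarz: "norm (ip x y) \<le> norm x * norm y"
proof (cases "y = 0")
  case False
  define a b where "a = (norm (ip x y))\<^sup>2" and "b = (norm y)\<^sup>2"
  have b: "b > 0"
    using False by (simp add: b_def)
  \<comment> \<open>The choice \<open>t = 1 / b\<close> makes the subtracted vector the projection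
    of \<open>x\<close> onto the line through \<open>y\<close>, which minimises the right-hand
    side.\<close>
  have "0 \<le> (norm x)\<^sup>2 - 2 * (1 / b) * a + (1 / b)\<^sup>2 * a * b"
    unfolding a_def b_def by (subst norm_diff_scale_ip[symmetric]) simp
  also have "\<dots> = (norm x)\<^sup>2 - a / b"
    using b by (simp add: power2_eq_square)
  finally have "a \<le> (norm x)\<^sup>2 * b"
    using b by (simp add: field_simps)
  then have "(norm (ip x y))\<^sup>2 \<le> (norm x * norm y)\<^sup>2"
    by (simp add: a_def b_def power_mult_distrib)
  then show ?thesis
    by (rule power2_le_imp_le) simp
qed simp

lemma norm_le_ip:
  assumes "norm (ip x x) \<le> c * norm x" and "c \<ge> 0"
  shows "norm x \<le> c"
  using assms by (cases "x = 0") (auto simp: ip_self power2_eq_square norm_mult)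

lemma bounded_linear_ip_left: "bounded_linear (\<lambda>x. ip x y)"
  by (rule bounded_linear_intro[where K = "norm y"])
    (auto simp: ip_add_left ip_scaleR_left Cauchy_Schwarz scaleR_conv_of_real)

text \<open>This plays the role of weak compactness. The infimal norms of the sets increase to a
  limit. Near-minimisers form a Cauchy sequence, because the midpoint of two of them stays in the
  set by convexity and so cannot be much shorter than they are.\<close>

lemma nested_closed_convex_nonempty:
  fixes K :: "nat \<Rightarrow> 'a set"
  assumes K: "\<And>n. K n \<noteq> {}" "\<And>n. closed (K n)" "\<And>n. convex (K n)"
    and dec: "\<And>m n. m \<le> n \<Longrightarrow> K n \<subseteq> K m"
    and bd: "\<And>x. x \<in> K 0 \<Longrightarrow> norm x \<le> b"
  shows "\<exists>x. \<forall>n. x \<in> K n"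
proof -
  define r where "r n = Inf (norm ` K n)" for n
  have bdd: "bdd_below (norm ` K n)" for n
    by (auto intro!: bdd_belowI[of _ 0])
  have r_le: "r n \<le> norm x" if "x \<in> K n" for n x
    unfolding r_def using that bdd by (intro cInf_lower) auto
  have r_nonneg: "0 \<le> r n" for n
    unfolding r_def using K by (intro cInf_greatest) auto
  have "incseq r"
    unfolding incseq_def r_def using K(1) dec bdd by (intro allI impI cInf_superset_mono image_mono) auto
  moreover have "r n \<le> b" for n
    using r_le[of _ n] K(1)[of n] dec[of 0 n] bd by (meson all_not_in_conv order_trans subsetD le0)
  ultimately obtain R where R: "r \<longlonglongrightarrow> R" "\<And>n. r n \<le> R"
    using incseq_convergent by metis
  have "\<exists>x\<in>K n. norm x < r n + 1 / real (Suc n)" for n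
    using cInf_lessD[of "norm ` K n" "r n + 1 / real (Suc n)"] K(1)[of n] unfolding r_def by auto
  then obtain x where x: "\<And>n. x n \<in> K n" "\<And>n. norm (x n) < r n + 1 / real (Suc n)"
    by metis
  \<comment> \<open>This is the parallelogram law for two vectors of norm at most
    \<open>R + 1 / real (Suc n)\<close> whose half-sum has norm at least \<open>r n\<close>.\<close>
  define g where "g n = 4 * ((R + 1 / real (Suc n))\<^sup>2 - (r n)\<^sup>2)" for n
  have "(\<lambda>n. 1 / real (Suc n)) \<longlonglongrightarrow> 0"
    using LIMSEQ_inverse_real_of_nat by (simp add: inverse_eq_divide)
  then have "g \<longlonglongrightarrow> 4 * ((R + 0)\<^sup>2 - R\<^sup>2)"
    unfolding g_def by (intro tendsto_intros R)
  then have g: "g \<longlonglongrightarrow> 0"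
    by simp
  have dist: "(dist (x m) (x n))\<^sup>2 \<le> g n" if "n \<le> m" for m n
  proof -
    have xs: "x m \<in> K n" "x n \<in> K n"
      using x(1) dec[OF that] by auto
    have "(1/2) *\<^sub>R x m + (1/2) *\<^sub>R x n \<in> K n"
      using K(3)[of n] xs by (intro convexD) auto
    then have "r n \<le> norm ((1/2) *\<^sub>R (x m + x n))"
      using r_le by (simp add: scaleR_add_right)
    then have "(2 * r n)\<^sup>2 \<le> (norm (x m + x n))\<^sup>2"
      using r_nonneg[of n] by (intro power_mono) auto
    moreover have "(norm (x k))\<^sup>2 \<le> (R + 1 / real (Suc n))\<^sup>2" if "n \<le> k" for k
    proof (intro power_mono)
      have "1 / real (Suc k) \<le> 1 / real (Suc n)"
        using that by (intro divide_left_mono) auto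
      then show "norm (x k) \<le> R + 1 / real (Suc n)"
        using x(2)[of k] R(2)[of k] by linarith
    qed simp
    note this[OF that] this[of n]
    ultimately show ?thesis
      using parallelogram[of "x m" "x n"] unfolding g_def dist_norm by (simp add: power_mult_distrib)
  qed
  have "Cauchy x"
  proof (rule metric_CauchyI)
    fix e :: real
    assume e: "0 < e"
    then obtain n where n: "g n < (e / 2)\<^sup>2"
      using order_tendstoD(2)[OF g, of "(e / 2)\<^sup>2"] by (auto simp: eventually_sequentially)
    have "dist (x m) (x n) < e / 2" if "n \<le> m" for m
      using dist[OF that] n e by (intro power2_less_imp_less[of _ "e / 2"]) auto
    then show "\<exists>k. \<forall>m\<ge>k. \<forall>n\<ge>k. dist (x m) (x n) < e"
      by (metis dist_triangle_half_l)
  qed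
  then obtain l where l: "x \<longlonglongrightarrow> l"
    using Cauchy_convergent convergentD by blast
  have "l \<in> K n" for n
  proof (rule Lim_in_closed_set[OF K(2) _ _ l])
    show "\<forall>\<^sub>F m in sequentially. x m \<in> K n"
      using x(1) dec unfolding eventually_sequentially by blast
  qed simp
  then show ?thesis
    by blast
qed

lemma closed_image_closed_convex_bounded:
  fixes G :: "'a \<Rightarrow> 'c::real_normed_vector"
  assumes G: "bounded_linear G" and F: "closed F" "convex F" "bounded F"
  shows "closed (G ` F)"
proof -
  have "y \<in> G ` F" if y: "y \<in> closure (G ` F)" for y
  proof -
    \<comment> \<open>Each slice is nonempty because \<open>y\<close> lies in the closure of the
      image. A point common to all slices is mapped exactly to \<open>y\<close>, since the balls
      shrink to it.\<close>
    define K where "K n = F \<inter> G -` cball y (1 / real (Suc n))" for n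
    obtain b where b: "\<And>x. x \<in> F \<Longrightarrow> norm x \<le> b"
      using F(3) bounded_iff by blast
    have "\<exists>x. \<forall>n. x \<in> K n"
    proof (rule nested_closed_convex_nonempty[of K b])
      show "K n \<noteq> {}" for n
      proof -
        obtain u where "u \<in> F" "dist (G u) y < 1 / real (Suc n)"
          using closure_approachableD[OF y, of "1 / real (Suc n)"] by (auto simp: dist_commute)
        then have "u \<in> K n"
          by (simp add: K_def dist_commute)
        then show ?thesis
          by blast
      qed
      show "closed (K n)" for n
        unfolding K_def
        by (intro closed_Int F continuous_closed_vimage closed_cball
            bounded_linear.isCont[OF G] continuous_ident)
      show "convex (K n)" for n
        unfolding K_def
        by (intro convex_Int F convex_linear_vimage convex_cball bounded_linear.linear[OF G])
      show "K n \<subseteq> K m" if "m \<le> n" for m n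
      proof -
        have "1 / real (Suc n) \<le> 1 / real (Suc m)"
          using that by (intro divide_left_mono) auto
        then show ?thesis
          unfolding K_def by auto
      qed
    qed (auto simp: K_def b)
    then obtain x where x: "\<And>n. x \<in> K n"
      by blast
    have "dist y (G x) \<le> 0"
    proof (rule LIMSEQ_le_const[OF LIMSEQ_inverse_real_of_nat])
      show "\<exists>N. \<forall>n\<ge>N. dist y (G x) \<le> inverse (real (Suc n))"
        using x by (auto simp: K_def inverse_eq_divide)
    qed
    then show ?thesis
      using x[of 0] by (auto simp: K_def)
  qed
  then show ?thesis
    using closure_subset_eq by blast
qed

section \<open>Closed subspaces, orthogonal projection and Riesz representation\<close>

lemma subspace_imp_convex: "subspace L \<Longrightarrow> convex L"
  unfolding convex_def by (metis scale_of_real subspace_add subspace_scale)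

lemma subspace_scaleR: "subspace L \<Longrightarrow> x \<in> L \<Longrightarrow> r *\<^sub>R x \<in> L"
  by (metis scale_of_real subspace_scale)

lemma subspace_ortho_compl: "subspace (ortho_compl ip L)"
  unfolding subspace_def ortho_compl_def by (auto simp: ip_add_left ip_scale_left)

lemma closed_ortho_compl: "closed (ortho_compl ip L)"
proof -
  have "ortho_compl ip L = (\<Inter>y\<in>L. (\<lambda>x. ip x y) -` {0})"
    unfolding ortho_compl_def by auto
  also have "closed \<dots>"
    by (intro closed_INT ballI continuous_closed_vimage closed_singleton
        bounded_linear.isCont[OF bounded_linear_ip_left] continuous_ident)
  finally show ?thesis .
qed

lemma closest_point_subspace:
  assumes L: "subspace L" "closed L"
  shows "\<exists>p\<in>L. \<forall>q\<in>L. norm (x - p) \<le> norm (x - q)"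
proof -
  define d where "d = infdist x L"
  have L_ne: "L \<noteq> {}"
    using subspace_0[OF L(1)] by blast
  \<comment> \<open>The radii decrease to the distance \<open>d\<close>, so a common point attains
    it. The first radius is \<open>d + 1\<close>, whence the norm bound in the next step.\<close>
  define K where "K n = L \<inter> cball x (d + 1 / real (Suc n))" for n
  have "\<exists>p. \<forall>n. p \<in> K n"
  proof (rule nested_closed_convex_nonempty[of K "norm x + (d + 1)"])
    show "K n \<noteq> {}" for n
    proof -
      have "\<exists>p\<in>L. dist x p < d + 1 / real (Suc n)"
        using L_ne cInf_lessD[of "dist x ` L" "d + 1 / real (Suc n)"]
        by (auto simp: d_def infdist_notempty)
      then show ?thesis
        unfolding K_def by force
    qed
    show "closed (K n)" "convex (K n)" for n
      unfolding K_def using L subspace_imp_convex by (auto intro: convex_Int)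
    show "K n \<subseteq> K m" if "m \<le> n" for m n
    proof -
      have "1 / real (Suc n) \<le> 1 / real (Suc m)"
        using that by (intro divide_left_mono) auto
      then show ?thesis
        unfolding K_def by auto
    qed
    show "norm p \<le> norm x + (d + 1)" if "p \<in> K 0" for p
      using that norm_triangle_ineq2[of p x] by (auto simp: K_def dist_norm norm_minus_commute)
  qed
  then obtain p where p: "\<And>n. p \<in> K n"
    by blast
  have "dist x p \<le> d + 0"
  proof (rule LIMSEQ_le_const)
    show "(\<lambda>n. d + inverse (real (Suc n))) \<longlonglongrightarrow> d + 0"
      by (intro tendsto_intros LIMSEQ_inverse_real_of_nat)
    show "\<exists>N. \<forall>n\<ge>N. dist x p \<le> d + inverse (real (Suc n))"
      using p by (auto simp: K_def inverse_eq_divide)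
  qed
  moreover have "d \<le> dist x q" if "q \<in> L" for q
    unfolding d_def using that by (rule infdist_le)
  ultimately show ?thesis
    using p[of 0] unfolding K_def dist_norm by force
qed

text \<open>Take \<open>p\<close> closest to \<open>x\<close>. If the residual were not orthogonal
  to some \<open>y\<close> in \<open>L\<close>, a small move of \<open>p\<close> along
  \<open>y\<close> would bring it closer: the gain is linear in the step size and the loss only
  quadratic.\<close>

lemma ortho_decomposition:
  assumes L: "subspace L" "closed L"
  shows "\<exists>p\<in>L. x - p \<in> ortho_compl ip L"
proof -
  obtain p where p: "p \<in> L" "\<And>q. q \<in> L \<Longrightarrow> norm (x - p) \<le> norm (x - q)"
    using closest_point_subspace[OF L] by blast
  have "ip (x - p) y = 0" if y: "y \<in> L" for y
  proof -
    \<comment> \<open>Adding 1 in the denominator keeps \<open>t\<close> defined for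
      \<open>y = 0\<close> and gives \<open>t * b \<le> 1\<close>. Minimality then yields
      \<open>2 * a \<le> a\<close>, hence \<open>a = 0\<close>.\<close>
    define a b t where "a = (norm (ip (x - p) y))\<^sup>2" and "b = (norm y)\<^sup>2" and "t = 1 / (b + 1)"
    have b: "b \<ge> 0"
      by (simp add: b_def)
    have "p + scale (of_real t * ip (x - p) y) y \<in> L"
      using L(1) p(1) y by (intro subspace_add subspace_scale)
    then have "norm (x - p) \<le> norm (x - p - scale (of_real t * ip (x - p) y) y)"
      using p(2) by (metis diff_diff_eq)
    then have "(norm (x - p))\<^sup>2 \<le> (norm (x - p - scale (of_real t * ip (x - p) y) y))\<^sup>2"
      by (rule power_mono) simp
    then have "2 * t * a \<le> t\<^sup>2 * a * b"
      unfolding norm_diff_scale_ip a_def b_def by simp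
    then have "t * (2 * a) \<le> t * (a * (t * b))"
      by (simp add: power2_eq_square ac_simps)
    then have "2 * a \<le> a * (t * b)"
      using b by (simp add: t_def divide_simps)
    moreover have "a * (t * b) \<le> a * 1"
      using b by (intro mult_left_mono) (auto simp: a_def t_def)
    moreover have "a \<ge> 0"
      by (simp add: a_def)
    ultimately have "a = 0"
      by linarith
    then show ?thesis
      by (simp add: a_def)
  qed
  then show ?thesis
    using p(1) by (auto simp: ortho_compl_def)
qed

text \<open>Two candidates differ by a vector lying both in \<open>L\<close> and in its complement,
  hence orthogonal to itself. This is how values of the definite description are computed
  below.\<close>

lemma ortho_proj_eqI:
  assumes L: "subspace L" and p: "p \<in> L" "x - p \<in> ortho_compl ip L"
  shows "ortho_proj ip L x = p"
  unfolding ortho_proj_def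
proof (rule the_equality)
  fix q
  assume q: "q \<in> L \<and> x - q \<in> ortho_compl ip L"
  have "p - q \<in> L"
    using L p(1) q by (intro subspace_diff) auto
  moreover have "p - q = (x - q) - (x - p)"
    by simp
  then have "p - q \<in> ortho_compl ip L"
    using p(2) q by (metis subspace_diff subspace_ortho_compl)
  ultimately have "ip (p - q) (p - q) = 0"
    by (simp add: ortho_compl_def)
  then show "q = p"
    by (simp add: ip_self)
qed (use p in simp)

context
  fixes L
  assumes L: "subspace L" "closed L"
begin

lemma ortho_proj_in: "ortho_proj ip L x \<in> L"
  and ortho_proj_compl: "x - ortho_proj ip L x \<in> ortho_compl ip L"
  using ortho_decomposition[OF L, of x] ortho_proj_eqI[OF L(1)] by metis+

lemma ip_ortho_proj_left: "y \<in> L \<Longrightarrow> ip (ortho_proj ip L x) y = ip x y"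
  using ortho_proj_compl[of x] by (auto simp: ortho_compl_def ip_diff_left)

text \<open>For the projection \<open>p\<close> of \<open>x\<close>, \<open>ip p p = ip x p\<close>,
  and Cauchy-Schwarz bounds the latter.\<close>

lemma norm_ortho_proj_le: "norm (ortho_proj ip L x) \<le> norm x"
  by (rule norm_le_ip) (use Cauchy_Schwarz ip_ortho_proj_left ortho_proj_in in auto)

lemma bounded_linear_ortho_proj: "bounded_linear (ortho_proj ip L)"
proof (rule bounded_linear_intro[where K = 1])
  fix x y r
  have "x + y - (ortho_proj ip L x + ortho_proj ip L y) =
      (x - ortho_proj ip L x) + (y - ortho_proj ip L y)"
    by simp
  then have "x + y - (ortho_proj ip L x + ortho_proj ip L y) \<in> ortho_compl ip L"
    by (metis subspace_add subspace_ortho_compl ortho_proj_compl)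
  then show "ortho_proj ip L (x + y) = ortho_proj ip L x + ortho_proj ip L y"
    by (intro ortho_proj_eqI subspace_add L ortho_proj_in)
  have "r *\<^sub>R x - r *\<^sub>R ortho_proj ip L x \<in> ortho_compl ip L"
    using subspace_scaleR[OF subspace_ortho_compl ortho_proj_compl] by (simp add: scaleR_diff_right)
  then show "ortho_proj ip L (r *\<^sub>R x) = r *\<^sub>R ortho_proj ip L x"
    by (intro ortho_proj_eqI subspace_scaleR L ortho_proj_in)
qed (simp add: norm_ortho_proj_le)

lemma riesz_representation:
  assumes f: "bounded_linear f" and f_scale: "\<And>c u. f (scale c u) = c * f u"
  shows "\<exists>x\<in>L. \<forall>u\<in>L. f u = ip u x"
proof (cases "\<forall>u\<in>L. f u = 0")
  case True
  then show ?thesis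
    using subspace_0[OF L(1)] by (intro bexI[of _ 0]) auto
next
  case False
  interpret f: bounded_linear f by fact
  \<comment> \<open>Within \<open>L\<close> the kernel has codimension one. The residual
    \<open>w\<close> of \<open>u0\<close> modulo the kernel spans the remaining direction and is
    orthogonal to it.\<close>
  define Z where "Z = L \<inter> f -` {0}"
  have Z: "subspace Z" "closed Z"
  proof -
    show "subspace Z"
      using L(1) unfolding Z_def subspace_def by (auto simp: f.add f_scale f.zero)
    show "closed Z"
      unfolding Z_def
      by (intro closed_Int L continuous_closed_vimage closed_singleton f.isCont continuous_ident)
  qed
  obtain u0 where u0: "u0 \<in> L" "f u0 \<noteq> 0"
    using False by blast
  obtain p where p: "p \<in> Z" "u0 - p \<in> ortho_compl ip Z"
    using ortho_decomposition[OF Z] by blast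
  define w where "w = u0 - p"
  have w: "w \<in> L" "f w \<noteq> 0" "\<And>u. u \<in> Z \<Longrightarrow> ip u w = 0"
  proof -
    show "w \<in> L" "f w \<noteq> 0"
      using u0 p(1) L(1) by (auto simp: w_def Z_def f.diff intro: subspace_diff)
    show "ip u w = 0" if "u \<in> Z" for u
      using p(2) that by (metis (mono_tags) ip_commute mem_Collect_eq ortho_compl_def scalar_cnj_0 w_def)
  qed
  have ww: "ip w w \<noteq> 0"
    using w(2) f.zero by (auto simp: ip_self)
  \<comment> \<open>The conjugate compensates for the conjugate-linearity of \<open>ip\<close> in
    its second argument; the quotient is fixed by testing at \<open>u = w\<close>.\<close>
  let ?x = "scale (scalar_cnj (f w / ip w w)) w"
  have "f u = ip u ?x" if u: "u \<in> L" for u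
  proof -
    \<comment> \<open>Removing the right multiple of \<open>w\<close> from \<open>u\<close> leaves a
      kernel element, so \<open>ip u w\<close> is determined by \<open>f u\<close>.\<close>
    have "u - scale (f u / f w) w \<in> Z"
      using u w L(1) unfolding Z_def
      by (auto simp: f.diff f_scale intro!: subspace_diff subspace_scale)
    then have "ip u w = f u / f w * ip w w"
      using w(3) by (force simp: ip_diff_left ip_scale_left)
    then show ?thesis
      using ww w(2) by (simp add: ip_scale_right)
  qed
  moreover have "?x \<in> L"
    using w(1) L(1) by (rule subspace_scale[rotated])
  ultimately show ?thesis
    by blast
qed

lemma eq_if_ip_eq:
  assumes "x \<in> L" "y \<in> L" and "\<And>u. u \<in> L \<Longrightarrow> ip u x = ip u y"
  shows "x = y"
proof -
  have "ip (x - y) (x - y) = 0"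
    using assms(3)[OF subspace_diff[OF L(1) assms(1,2)]] by (simp add: ip_diff_right)
  then show ?thesis
    by (simp add: ip_self)
qed

section \<open>Unit balls of subspaces and closedness of an inclusion between their images\<close>

lemma closed_unit_ball_of: "closed (unit_ball_of L)"
  and convex_unit_ball_of: "convex (unit_ball_of L)"
  and bounded_unit_ball_of: "bounded (unit_ball_of L)"
proof -
  have "unit_ball_of L = L \<inter> cball 0 1"
    by (auto simp: unit_ball_of_def)
  then show "closed (unit_ball_of L)" "convex (unit_ball_of L)" "bounded (unit_ball_of L)"
    using L by (auto intro: closed_Int convex_Int subspace_imp_convex bounded_subset[OF bounded_cball])
qed

end

text \<open>The families are abstract because the criterion serves both inclusions: once for the
  blocks and once for the adjoints, where the two Hilbert spaces exchange roles. Only the larger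
  image has to be closed, so only \<open>G\<close> is assumed linear.\<close>

lemma closedin_image_subset_scaled_image:
  fixes G :: "'z::metric_space \<Rightarrow> 'a \<Rightarrow> 'c::real_normed_vector"
    and G' :: "'z \<Rightarrow> 'e::real_normed_vector \<Rightarrow> 'c"
  assumes G: "\<And>z. z \<in> S \<Longrightarrow> bounded_linear (G z)"
    and lip: "\<And>z w x. z \<in> S \<Longrightarrow> w \<in> S \<Longrightarrow> norm (G z x - G w x) \<le> dist z w * norm x"
    and lip': "\<And>z w x. z \<in> S \<Longrightarrow> w \<in> S \<Longrightarrow> norm (G' z x - G' w x) \<le> dist z w * norm x"
    and X: "subspace X" "closed X"
  shows "closedin (top_of_set S)
    {z \<in> S. G' z ` unit_ball_of Y \<subseteq> (\<lambda>y. lam *\<^sub>R y) ` G z ` unit_ball_of X}"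
  unfolding closedin_limpt
proof (intro conjI allI impI; (elim conjE)?)
  fix l
  assume "l islimpt {z \<in> S. G' z ` unit_ball_of Y \<subseteq> (\<lambda>y. lam *\<^sub>R y) ` G z ` unit_ball_of X}"
    and l: "l \<in> S"
  then obtain z where lim: "z \<longlonglongrightarrow> l" and
    z: "\<And>n. z n \<in> {z \<in> S. G' z ` unit_ball_of Y \<subseteq> (\<lambda>y. lam *\<^sub>R y) ` G z ` unit_ball_of X}"
    unfolding islimpt_sequential by blast
  have zS: "z n \<in> S" for n
    using z by blast
  have "G' l x \<in> (\<lambda>y. lam *\<^sub>R y) ` G l ` unit_ball_of X" if x: "x \<in> unit_ball_of Y" for x
  proof -
    have "\<exists>u\<in>unit_ball_of X. G' (z n) x = lam *\<^sub>R G (z n) u" for n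
      using z x by blast
    then obtain u where u: "\<And>n. u n \<in> unit_ball_of X" "\<And>n. G' (z n) x = lam *\<^sub>R G (z n) (u n)"
      by metis
    \<comment> \<open>Replacing \<open>z n\<close> by \<open>l\<close> costs
      \<open>dist (z n) l\<close> in the \<open>G'\<close> term and \<open>\<bar>lam\<bar>\<close>
      times that in the \<open>G\<close> term. The estimate is uniform over the unit ball, so no
      convergence of \<open>u\<close> is required.\<close>
    have le: "norm (lam *\<^sub>R G l (u n) - G' l x) \<le> (\<bar>lam\<bar> + 1) * dist (z n) l" for n
    proof -
      have "lam *\<^sub>R G l (u n) - G' l x =
          (G' (z n) x - G' l x) - lam *\<^sub>R (G (z n) (u n) - G l (u n))"
        by (simp add: u(2) scaleR_diff_right)
      then have "norm (lam *\<^sub>R G l (u n) - G' l x) \<le>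
          norm (G' (z n) x - G' l x) + \<bar>lam\<bar> * norm (G (z n) (u n) - G l (u n))"
        by (metis norm_scaleR norm_triangle_ineq4)
      also have "\<dots> \<le> dist (z n) l * 1 + \<bar>lam\<bar> * (dist (z n) l * 1)"
        using x u(1)[of n] unfolding unit_ball_of_def
        by (intro add_mono mult_left_mono order_trans[OF lip[OF zS l]] order_trans[OF lip'[OF zS l]])
          auto
      finally show ?thesis
        by (simp add: algebra_simps)
    qed
    have "(\<lambda>n. (\<bar>lam\<bar> + 1) * dist (z n) l) \<longlonglongrightarrow> 0"
      using lim by (intro tendsto_mult_right_zero) (simp flip: tendsto_dist_iff)
    then have "(\<lambda>n. lam *\<^sub>R G l (u n) - G' l x) \<longlonglongrightarrow> 0"
      by (rule Lim_null_comparison[rotated]) (use le in simp)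
    then have "(\<lambda>n. lam *\<^sub>R G l (u n)) \<longlonglongrightarrow> G' l x"
      by (rule LIM_zero_cancel)
    moreover have "closed ((\<lambda>y. lam *\<^sub>R y) ` G l ` unit_ball_of X)"
      by (intro closed_scaling closed_image_closed_convex_bounded G l closed_unit_ball_of
          convex_unit_ball_of bounded_unit_ball_of X)
    ultimately show ?thesis
      using u(1) by (elim closed_sequentially[rotated -1]) (assumption, intro imageI)
  qed
  then show "l \<in> {z \<in> S. G' z ` unit_ball_of Y \<subseteq> (\<lambda>y. lam *\<^sub>R y) ` G z ` unit_ball_of X}"
    using l by blast
qed auto

end

section \<open>Adjoints on closed subspaces\<close>

text \<open>\<open>X\<close> is the domain of the operators whose adjoints are formed, later the
  orthogonal complement of \<open>M\<close>. No codomain subspace is fixed, so that one function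
  \<open>adj T\<close> can stand for the adjoints of both blocks.\<close>

locale hilbert_space_pair =
  H: hilbert_space scaleH ipH + K: hilbert_space scaleK ipK
  for scaleH :: "'k::rc_field \<Rightarrow> 'a::banach \<Rightarrow> 'a" and ipH :: "'a \<Rightarrow> 'a \<Rightarrow> 'k"
    and scaleK :: "'k \<Rightarrow> 'b::banach \<Rightarrow> 'b" and ipK :: "'b \<Rightarrow> 'b \<Rightarrow> 'k" +
  fixes X :: "'a set"
  assumes X: "H.subspace X" "closed X"
begin

abbreviation adj :: "('a \<Rightarrow>\<^sub>L 'b) \<Rightarrow> 'b \<Rightarrow> 'a"
  where "adj T \<equiv> adjoint_on ipH ipK X (blinfun_apply T)"

text \<open>Riesz representation on \<open>X\<close>, applied to the functional pairing
  \<open>T u\<close> with \<open>y\<close>, makes the definite description in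
  \<open>adjoint_on\<close> meaningful. Membership in \<open>bounded_ops\<close> supplies its
  homogeneity over the scalar field.\<close>

lemma adj_ex1:
  assumes "T \<in> bounded_ops scaleH scaleK"
  shows "\<exists>!x. x \<in> X \<and> (\<forall>u\<in>X. ipK (blinfun_apply T u) y = ipH u x)"
proof -
  have "bounded_linear (\<lambda>u. ipK (blinfun_apply T u) y)"
    using bounded_linear_compose[OF K.bounded_linear_ip_left blinfun.bounded_linear_right] .
  moreover have "ipK (blinfun_apply T (scaleH c u)) y = c * ipK (blinfun_apply T u) y" for c u
    using assms by (simp add: bounded_ops_def K.ip_scale_left)
  ultimately have "\<exists>x\<in>X. \<forall>u\<in>X. ipK (blinfun_apply T u) y = ipH u x"
    by (intro H.riesz_representation X)
  then show ?thesis
    by (metis H.eq_if_ip_eq[OF X])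
qed

lemma
  assumes "T \<in> bounded_ops scaleH scaleK"
  shows adj_in: "adj T y \<in> X"
    and ip_adj: "u \<in> X \<Longrightarrow> ipH u (adj T y) = ipK (blinfun_apply T u) y"
proof -
  have "adj T y \<in> X \<and> (\<forall>u\<in>X. ipK (blinfun_apply T u) y = ipH u (adj T y))"
    using adj_ex1[OF assms] unfolding adjoint_on_def by (rule theI')
  then show "adj T y \<in> X" and "u \<in> X \<Longrightarrow> ipH u (adj T y) = ipK (blinfun_apply T u) y"
    by simp_all
qed

lemma adj_eqI:
  assumes "T \<in> bounded_ops scaleH scaleK" and "x \<in> X"
    and "\<And>u. u \<in> X \<Longrightarrow> ipH u x = ipK (blinfun_apply T u) y"
  shows "adj T y = x"
  using assms by (intro H.eq_if_ip_eq[OF X]) (auto simp: adj_in ip_adj)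

text \<open>The difference \<open>d\<close> of the two adjoint values lies in \<open>X\<close> and
  can be tested against itself: its squared norm is the pairing of \<open>(T - T') d\<close> with
  \<open>y\<close>.\<close>

lemma norm_adj_diff_le:
  assumes T: "T \<in> bounded_ops scaleH scaleK" "T' \<in> bounded_ops scaleH scaleK"
  shows "norm (adj T y - adj T' y) \<le> dist T T' * norm y"
proof (rule H.norm_le_ip)
  let ?d = "adj T y - adj T' y"
  have "?d \<in> X"
    using T by (intro H.subspace_diff X adj_in)
  then have "ipH ?d ?d = ipK (blinfun_apply (T - T') ?d) y"
    using T by (simp add: H.ip_diff_right ip_adj blinfun.diff_left K.ip_diff_left)
  also have "norm \<dots> \<le> norm (T - T') * norm ?d * norm y"
    by (intro order_trans[OF K.Cauchy_Schwarz] mult_right_mono norm_blinfun) simp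
  finally show "norm (ipH ?d ?d) \<le> dist T T' * norm y * norm ?d"
    by (simp add: dist_norm ac_simps)
qed simp

lemma bounded_linear_adj:
  assumes T: "T \<in> bounded_ops scaleH scaleK"
  shows "bounded_linear (adj T)"
proof (rule bounded_linear_intro[where K = "norm T"])
  fix x y r
  show "adj T (x + y) = adj T x + adj T y"
    using T by (intro adj_eqI H.subspace_add X adj_in) (simp_all add: H.ip_add_right K.ip_add_right ip_adj)
  show "adj T (r *\<^sub>R x) = r *\<^sub>R adj T x"
    using T by (intro adj_eqI H.subspace_scaleR X adj_in)
      (simp_all add: H.ip_scaleR_right K.ip_scaleR_right ip_adj)
  \<comment> \<open>Comparison with the zero operator turns the Lipschitz estimate into the norm
    bound for \<open>adj T\<close>.\<close>
  have 0: "0 \<in> bounded_ops scaleH scaleK"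
    by (simp add: bounded_ops_def)
  have "adj 0 x = 0"
    using 0 by (intro adj_eqI H.subspace_0 X) simp_all
  then show "norm (adj T x) \<le> norm x * norm T"
    using norm_adj_diff_le[OF T 0, of x] by (simp add: mult.commute)
qed

text \<open>Projecting \<open>T u\<close> onto \<open>Y\<close> does not change its pairing with a
  vector of \<open>Y\<close>. Hence the adjoints of \<open>B\<close> and \<open>D\<close> are one
  function, \<open>adj T\<close>, restricted to \<open>N\<close> and to its complement.\<close>

lemma adjoint_on_block:
  assumes "K.subspace Y" "closed Y" and "y \<in> Y"
  shows "adjoint_on ipH ipK X (block ipK Y T) y = adj T y"
  unfolding adjoint_on_def block_def using assms by (simp add: K.ip_ortho_proj_left)

end

theorem corollary4p2:
  fixes scaleH :: "'k::rc_field \<Rightarrow> 'a::banach \<Rightarrow> 'a" and ipH :: "'a \<Rightarrow> 'a \<Rightarrow> 'k"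
    and scaleK :: "'k \<Rightarrow> 'b::banach \<Rightarrow> 'b" and ipK :: "'b \<Rightarrow> 'b \<Rightarrow> 'k"
    and M :: "'a set" and N :: "'b set" and lam :: real
  assumes "hilbert_space scaleH ipH" and "hilbert_space scaleK ipK"
    and "module.subspace scaleH M" and "closed M"
    and "module.subspace scaleK N" and "closed N"
    and "lam > 0"
  shows "closedin (top_of_set (closed_range_D_ops scaleH ipH scaleK ipK M N))
           (complementable_ops scaleH ipH scaleK ipK M N lam \<inter>
            closed_range_D_ops scaleH ipH scaleK ipK M N)"
proof -
  interpret H: hilbert_space scaleH ipH by fact
  interpret K: hilbert_space scaleK ipK by fact
  let ?S = "closed_range_D_ops scaleH ipH scaleK ipK M N"
  let ?M' = "ortho_compl ipH M" and ?N' = "ortho_compl ipK N"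
  interpret hilbert_space_pair scaleH ipH scaleK ipK ?M'
    by unfold_locales (rule H.subspace_ortho_compl H.closed_ortho_compl)+
  let ?D = "block ipK ?N'"
  have S: "T \<in> bounded_ops scaleH scaleK" if "T \<in> ?S" for T
    using that by (simp add: closed_range_D_ops_def)
  have N': "K.subspace ?N'" "closed ?N'"
    by (rule K.subspace_ortho_compl K.closed_ortho_compl)+
  interpret P: bounded_linear "ortho_proj ipK ?N'"
    by (rule K.bounded_linear_ortho_proj[OF N'])
  have lin_D: "bounded_linear (?D T)" for T
    unfolding block_def by (rule bounded_linear_compose[OF P.bounded_linear blinfun.bounded_linear_right])
  have lip_D: "norm (?D T x - ?D T' x) \<le> dist T T' * norm x" for T T' x
  proof -
    have "norm (?D T x - ?D T' x) \<le> norm (blinfun_apply (T - T') x)"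
      unfolding block_def P.diff[symmetric] blinfun.diff_left by (rule K.norm_ortho_proj_le[OF N'])
    also have "\<dots> \<le> dist T T' * norm x"
      unfolding dist_norm by (rule norm_blinfun)
    finally show ?thesis .
  qed
  have "closedin (top_of_set ?S)
      {T \<in> ?S. ?D T ` unit_ball_of M \<subseteq> (\<lambda>y. lam *\<^sub>R y) ` ?D T ` unit_ball_of ?M'}"
    \<comment> \<open>The blocks \<open>C\<close> and \<open>D\<close> are the same function on
      different domains, so one Lipschitz estimate serves as both premises.\<close>
    by (rule H.closedin_image_subset_scaled_image[OF lin_D lip_D lip_D X])
  moreover have "closedin (top_of_set ?S)
      {T \<in> ?S. adj T ` unit_ball_of N \<subseteq> (\<lambda>x. lam *\<^sub>R x) ` adj T ` unit_ball_of ?N'}"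
    \<comment> \<open>The adjoints start in the second Hilbert space, so here the closed image comes
      from a unit ball in that space.\<close>
    by (rule K.closedin_image_subset_scaled_image)
      (simp_all add: S bounded_linear_adj norm_adj_diff_le N')
  ultimately have "closedin (top_of_set ?S)
      ({T \<in> ?S. ?D T ` unit_ball_of M \<subseteq> (\<lambda>y. lam *\<^sub>R y) ` ?D T ` unit_ball_of ?M'} \<inter>
       {T \<in> ?S. adj T ` unit_ball_of N \<subseteq> (\<lambda>x. lam *\<^sub>R x) ` adj T ` unit_ball_of ?N'})"
    by (rule closedin_Int)
  also have "\<dots> = complementable_ops scaleH ipH scaleK ipK M N lam \<inter> ?S"
  proof -
    have B_adj: "adjoint_on ipH ipK ?M' (block ipK N T) ` unit_ball_of N = adj T ` unit_ball_of N" for T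
      using assms by (intro image_cong refl adjoint_on_block) (auto simp: unit_ball_of_def)
    have D_adj: "adjoint_on ipH ipK ?M' (?D T) ` unit_ball_of ?N' = adj T ` unit_ball_of ?N'" for T
      using N' by (intro image_cong refl adjoint_on_block) (auto simp: unit_ball_of_def)
    show ?thesis
      unfolding complementable_ops_def Let_def B_adj D_adj using S by blast
  qed
  finally show ?thesis .
qed

end
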